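(* Let $q$ be a prime power, let $n\geq1$ and $0\leq k\leq n$ be integers, and let $U$ be an $(n-k)$-dimensional linear subspace of $\mathbb{F}_q^n$. Let $U+t_{U,1},\dots,U+t_{U,q^k}$ be the $q^k$ distinct cosets of $U$ in $\mathbb{F}_q^n$. Then for any $f:\mathbb{F}_q^n\to\mathbb{C}$, $$\sum_{m\in U^\perp}|\widehat f(m)|^2=q^{-2n+k}\sum_{j=1}^{q^k}\big|S_f(U+t_{U,j})\big|^2.$$
   Context: $\mathbb{F}_q$ is the finite field with $q$ elements, $x\cdot y\in\mathbb{F}_q$ is the usual dot product on $\mathbb{F}_q^n$, and $U^\perp=\{y\in\mathbb{F}_q^n: x\cdot y=0\text{ for all }x\in U\}$. Fix a nontrivial additive character $\chi:\mathbb{F}_q\to S^1\subseteq\mathbb{C}$; the Fourier transform of $f$ is $\widehat f(m)=q^{-n}\sum_{x\in\mathbb{F}_q^n}f(x)\chi(-m\cdot x)$. For $A\subseteq\mathbb{F}_q^n$, $S_f(A)=\sum_{a\in A}f(a)$. *)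

theory Defs
  imports "HOL-Analysis.Analysis"
begin

text \<open>
  The finite field with \<open>q\<close> elements is a type \<open>'q\<close> of sort \<open>{field, finite}\<close>, so that
  \<open>q = CARD('q)\<close>; the space of dimension \<open>n\<close> over it is the type \<open>'q ^ 'n\<close> with
  \<open>n = CARD('n)\<close>, which is at least \<open>1\<close> because types are nonempty. Linear subspaces and their
  dimensions over \<open>'q\<close> are those of the library's \<open>vec\<close> interpretation of vector spaces.
\<close>

text \<open>The library's inner product is real-valued, hence a separate dot product over a field.\<close>

definition dot_prod :: "'q::field ^ 'n \<Rightarrow> 'q ^ 'n \<Rightarrow> 'q" where
  "dot_prod x y = (\<Sum>i\<in>UNIV. x $ i * y $ i)"

definition perp :: "('q::field ^ 'n) set \<Rightarrow> ('q ^ 'n) set" where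
  "perp U = {y. \<forall>x\<in>U. dot_prod x y = 0}"

definition additive_character :: "('q::field \<Rightarrow> complex) \<Rightarrow> bool" where
  "additive_character chi \<longleftrightarrow>
     (\<forall>x. chi x \<in> sphere 0 1) \<and> (\<forall>x y. chi (x + y) = chi x * chi y)"

definition nontrivial_additive_character :: "('q::field \<Rightarrow> complex) \<Rightarrow> bool" where
  "nontrivial_additive_character chi \<longleftrightarrow> additive_character chi \<and> (\<exists>x. chi x \<noteq> 1)"

definition fourier ::
    "('q::{field,finite} \<Rightarrow> complex) \<Rightarrow> ('q ^ 'n \<Rightarrow> complex) \<Rightarrow> 'q ^ 'n \<Rightarrow> complex" where
  "fourier chi f m =
     of_nat CARD('q) powi (- int CARD('n)) * (\<Sum>x\<in>UNIV. f x * chi (dot_prod (- m) x))"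

definition sum_over :: "('q::{field,finite} ^ 'n \<Rightarrow> complex) \<Rightarrow> ('q ^ 'n) set \<Rightarrow> complex" where
  "sum_over f A = (\<Sum>a\<in>A. f a)"

definition translate :: "('q::field ^ 'n) set \<Rightarrow> 'q ^ 'n \<Rightarrow> ('q ^ 'n) set" where
  "translate U t = {u + t | u. u \<in> U}"

end

theory Submission
  imports Defs
begin

text \<open>
  Everything follows from orthogonality: for a subspace \<open>W\<close>, the sum of \<open>\<chi>(m \<cdot> y)\<close> over
  \<open>m \<in> W\<close> is \<open>|W|\<close> if \<open>y \<in> W\<^sup>\<bottom>\<close> and \<open>0\<close> otherwise. Summing \<open>\<chi>(m \<cdot> u)\<close> over all \<open>m\<close> and all
  \<open>u \<in> W\<close> in both orders gives \<open>|W| |W\<^sup>\<bottom>| = q\<^sup>n\<close>; hence \<open>W\<^sup>\<bottom>\<^sup>\<bottom> = W\<close> by counting. Expanding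
  the squared modulus of the Fourier coefficient at \<open>m\<close> as a double sum over \<open>x, y\<close> and summing over \<open>m \<in> U\<^sup>\<bottom>\<close> leaves exactly the pairs
  with \<open>y - x \<in> U\<close>, that is, the pairs in a common coset of \<open>U\<close>.
\<close>

lemma dot_prod_commute: "dot_prod x y = dot_prod y x"
  by (simp add: dot_prod_def mult.commute)

lemma dot_prod_add_right: "dot_prod x (y + z) = dot_prod x y + dot_prod x z"
  by (simp add: dot_prod_def algebra_simps sum.distrib)

lemma dot_prod_add_left: "dot_prod (x + y) z = dot_prod x z + dot_prod y z"
  by (simp add: dot_prod_def algebra_simps sum.distrib)

lemma dot_prod_minus_left: "dot_prod (- x) y = - dot_prod x y"
  by (simp add: dot_prod_def sum_negf)

lemma dot_prod_diff_right: "dot_prod x (y - z) = dot_prod x y - dot_prod x z"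
  by (simp add: dot_prod_def algebra_simps sum_subtractf)

lemma dot_prod_scale_left: "dot_prod (c *s x) y = c * dot_prod x y"
  by (simp add: dot_prod_def sum_distrib_left mult.assoc)

lemma dot_prod_zero_right [simp]: "dot_prod x 0 = 0"
  by (simp add: dot_prod_def)

lemma dot_prod_axis_left: "dot_prod (axis i 1) y = y $ i"
proof -
  have "dot_prod (axis i 1) y = (\<Sum>j\<in>UNIV. if i = j then y $ j else 0)"
    unfolding dot_prod_def by (rule sum.cong) (auto simp: axis_def)
  then show ?thesis by simp
qed

text \<open>Pairing with the axis vectors reads off every coordinate of \<open>y\<close>.\<close>

lemma perp_UNIV: "perp UNIV = {0}"
proof -
  have "y = 0" if "\<forall>x. dot_prod x y = 0" for y :: "'a::field ^ 'n"
    using that dot_prod_axis_left[of _ y] by (simp add: vec_eq_iff)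
  then show ?thesis by (auto simp: perp_def)
qed

lemma subspace_perp: "vec.subspace (perp U)"
  by (auto simp: vec.subspace_def perp_def dot_prod_add_right dot_prod_commute[of _ "_ *s _"]
      dot_prod_scale_left) (metis dot_prod_commute mult_zero_right)

lemma subset_perp_perp: "U \<subseteq> perp (perp U)"
  by (auto simp: perp_def dot_prod_commute)

lemma additive_character_zero:
  assumes "additive_character chi"
  shows "chi 0 = 1"
proof -
  have "chi 0 = chi 0 * chi 0" "cmod (chi 0) = 1"
    using assms by (auto simp: additive_character_def dest: spec[of _ 0])
  then show ?thesis by auto
qed

text \<open>Both sides are inverses of \<open>chi x\<close>: one because \<open>chi 0 = 1\<close>,
  the other because \<open>chi x\<close> lies on the unit circle.\<close>

lemma additive_character_minus:
  assumes "additive_character chi"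
  shows "chi (- x) = cnj (chi x)"
proof -
  have "chi x * chi (- x) = 1"
    using assms additive_character_zero[OF assms] unfolding additive_character_def
    by (metis right_minus)
  moreover have "chi x * cnj (chi x) = 1"
    using assms by (simp add: additive_character_def complex_norm_square[symmetric])
  ultimately show ?thesis
    by (metis mult.commute mult.left_commute mult_1_right)
qed

text \<open>If some functional value on \<open>W\<close> is nonzero, translating the summation
  variable by a suitable \<open>v\<close> in \<open>W\<close> permutes \<open>W\<close> but
  multiplies the sum by a factor other than 1, so the sum vanishes.\<close>

lemma sum_character_subspace:
  fixes chi :: "'q::{field,finite} \<Rightarrow> complex" and W :: "('q ^ 'n) set"
  assumes chi: "nontrivial_additive_character chi" and W: "vec.subspace W"
  shows "(\<Sum>m\<in>W. chi (dot_prod m y)) = (if y \<in> perp W then of_nat (card W) else 0)"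
proof (cases "y \<in> perp W")
  case True
  then show ?thesis
    using chi additive_character_zero[of chi]
    by (simp add: perp_def nontrivial_additive_character_def)
next
  case False
  then obtain w where w: "w \<in> W" "dot_prod w y \<noteq> 0"
    by (auto simp: perp_def)
  obtain c where c: "chi c \<noteq> 1"
    using chi by (auto simp: nontrivial_additive_character_def)
  \<comment> \<open>Rescaling \<open>w\<close> makes its product with \<open>y\<close> equal to
    \<open>c\<close>, where \<open>chi\<close> is known to differ from 1.\<close>
  define v where "v = (c / dot_prod w y) *s w"
  have v: "v \<in> W" "dot_prod v y = c"
    using w W by (auto simp: v_def dot_prod_scale_left vec.subspace_scale)
  have "(\<Sum>m\<in>W. chi (dot_prod m y)) = (\<Sum>m\<in>W. chi (dot_prod (m + v) y))"
    by (rule sum.reindex_bij_witness[where i = "\<lambda>m. m + v" and j = "\<lambda>m. m - v"])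
      (auto intro: vec.subspace_add vec.subspace_diff W v)
  also have "\<dots> = (\<Sum>m\<in>W. chi (dot_prod m y)) * chi c"
    using chi by (simp add: dot_prod_add_left v nontrivial_additive_character_def
        additive_character_def sum_distrib_right)
  finally show ?thesis using c False by auto
qed

lemma card_mult_card_perp:
  fixes chi :: "'q::{field,finite} \<Rightarrow> complex" and W :: "('q ^ 'n) set"
  assumes chi: "nontrivial_additive_character chi" and W: "vec.subspace W"
  shows "card W * card (perp W) = CARD('q) ^ CARD('n)"
proof -
  have "of_nat (card W * card (perp W)) = (\<Sum>y\<in>UNIV. \<Sum>m\<in>W. chi (dot_prod m y))"
    by (simp add: sum_character_subspace[OF chi W] sum.If_cases mult.commute)
  \<comment> \<open>Symmetry of the product lets \<open>y\<close> take the role of the summed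
    variable, so that orthogonality applies again, now with the whole space as the subspace.\<close>
  also have "\<dots> = (\<Sum>m\<in>W. \<Sum>y\<in>UNIV. chi (dot_prod y m))"
    by (subst sum.swap) (simp add: dot_prod_commute)
  also have "\<dots> = (\<Sum>m\<in>W. if m = 0 then of_nat (CARD('q) ^ CARD('n)) else 0)"
    by (simp add: sum_character_subspace[OF chi vec.subspace_UNIV] perp_UNIV)
  also have "\<dots> = of_nat (CARD('q) ^ CARD('n))"
    using vec.subspace_0[OF W] by (subst sum.delta) auto
  finally show ?thesis by (simp only: of_nat_eq_iff)
qed

text \<open>Counting for \<open>W\<close> and for \<open>perp W\<close> gives \<open>W\<close> and
  its double complement the same size, and one contains the other. The character serves to supply
  these counts.\<close>

lemma perp_perp:
  fixes chi :: "'q::{field,finite} \<Rightarrow> complex" and W :: "('q ^ 'n) set"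
  assumes chi: "nontrivial_additive_character chi" and W: "vec.subspace W"
  shows "perp (perp W) = W"
proof -
  have "card W * card (perp W) = card (perp (perp W)) * card (perp W)"
    using card_mult_card_perp[OF chi W] card_mult_card_perp[OF chi subspace_perp[of W]]
    by (simp add: mult.commute)
  moreover have "card (perp W) \<noteq> 0"
    using vec.subspace_0[OF subspace_perp[of W]] by (auto simp: card_eq_0_iff)
  ultimately have "card W = card (perp (perp W))" by simp
  then show ?thesis
    using card_subset_eq[OF finite subset_perp_perp, of W] by simp
qed

lemma mem_translate_iff: "x \<in> translate U t \<longleftrightarrow> x - t \<in> U"
  by (auto simp: translate_def) (metis diff_add_cancel)

lemma translate_eq_iff:
  assumes U: "vec.subspace U"
  shows "translate U x = translate U s \<longleftrightarrow> x \<in> translate U s"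
proof
  assume "translate U x = translate U s"
  then show "x \<in> translate U s"
    using vec.subspace_0[OF U] by (metis mem_translate_iff diff_self)
next
  assume x: "x \<in> translate U s"
  have "y - x \<in> U \<longleftrightarrow> y - s \<in> U" for y
  proof
    show "y - x \<in> U \<Longrightarrow> y - s \<in> U"
      using vec.subspace_add[OF U, of "y - x" "x - s"] x by (simp add: mem_translate_iff)
    show "y - s \<in> U \<Longrightarrow> y - x \<in> U"
      using vec.subspace_diff[OF U, of "y - s" "x - s"] x by (simp add: mem_translate_iff)
  qed
  then show "translate U x = translate U s"
    by (auto simp: mem_translate_iff)
qed

lemma card_translate: "card (translate U t) = card U"
proof -
  have "translate U t = (\<lambda>u. u + t) ` U"
    by (auto simp: translate_def)
  then show ?thesis by (simp add: card_image)
qed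

text \<open>The fibre of \<open>translate U\<close> over a coset is that coset itself, so grouping
  by the value of \<open>translate U\<close> visits each coset once without choosing
  representatives.\<close>

lemma sum_group_cosets:
  fixes U :: "('q::{field,finite} ^ 'n) set" and g :: "'q ^ 'n \<Rightarrow> 'b::comm_monoid_add"
  assumes U: "vec.subspace U"
  shows "(\<Sum>x\<in>UNIV. g x) = (\<Sum>C\<in>range (translate U). \<Sum>x\<in>C. g x)"
proof -
  have "(\<Sum>x\<in>UNIV. g x) = (\<Sum>C\<in>range (translate U). \<Sum>x\<in>{x \<in> UNIV. translate U x = C}. g x)"
    by (rule sum.image_gen) simp
  also have "\<dots> = (\<Sum>C\<in>range (translate U). \<Sum>x\<in>C. g x)"
    using translate_eq_iff[OF U] by (intro sum.cong) auto
  finally show ?thesis .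
qed

lemma card_cosets_mult_card:
  fixes U :: "('q::{field,finite} ^ 'n) set"
  assumes U: "vec.subspace U"
  shows "card (range (translate U)) * card U = CARD('q) ^ CARD('n)"
proof -
  have "CARD('q) ^ CARD('n) = (\<Sum>C\<in>range (translate U). \<Sum>x\<in>C. 1)"
    using sum_group_cosets[OF U, of "\<lambda>_. 1 :: nat"] by simp
  also have "\<dots> = (\<Sum>C\<in>range (translate U). card U)"
    by (rule sum.cong) (auto simp: card_translate)
  finally show ?thesis by simp
qed

text \<open>Expanding each squared modulus gives a sum over pairs in one coset \<open>C\<close>, and
  \<open>C\<close> is \<open>translate U x\<close> for each of its elements
  \<open>x\<close>.\<close>

lemma sum_norm_sum_over_cosets:
  fixes U :: "('q::{field,finite} ^ 'n) set"
  assumes U: "vec.subspace U"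
  shows "complex_of_real (\<Sum>C\<in>range (translate U). (cmod (sum_over f C))\<^sup>2) =
    (\<Sum>x\<in>UNIV. \<Sum>y\<in>translate U x. f x * cnj (f y))"
proof -
  have "(\<Sum>x\<in>UNIV. \<Sum>y\<in>translate U x. f x * cnj (f y)) =
      (\<Sum>C\<in>range (translate U). \<Sum>x\<in>C. \<Sum>y\<in>translate U x. f x * cnj (f y))"
    by (rule sum_group_cosets[OF U])
  also have "\<dots> = (\<Sum>C\<in>range (translate U). \<Sum>x\<in>C. \<Sum>y\<in>C. f x * cnj (f y))"
    using translate_eq_iff[OF U] by (intro sum.cong) auto
  also have "\<dots> = (\<Sum>C\<in>range (translate U). sum_over f C * cnj (sum_over f C))"
    by (simp add: sum_over_def sum_product)
  finally show ?thesis
    by (simp only: of_real_sum complex_norm_square)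
qed

lemma norm_fourier_square:
  fixes chi :: "'q::{field,finite} \<Rightarrow> complex" and f :: "'q ^ 'n \<Rightarrow> complex"
  assumes chi: "additive_character chi"
  shows "complex_of_real ((cmod (fourier chi f m))\<^sup>2) =
    of_nat CARD('q) powi (- 2 * int CARD('n)) *
      (\<Sum>x\<in>UNIV. \<Sum>y\<in>UNIV. f x * cnj (f y) * chi (dot_prod m (y - x)))"
proof -
  define Q :: complex where "Q = of_nat CARD('q) powi (- int CARD('n))"
  have Q: "Q * cnj Q = of_nat CARD('q) powi (- 2 * int CARD('n))"
    by (simp add: Q_def flip: power_int_add)
  \<comment> \<open>Used with \<open>a\<close> and \<open>b\<close> the products of \<open>m\<close>
    with \<open>x\<close> and \<open>y\<close>: the two phases merge into one that depends only on
    \<open>y - x\<close>.\<close>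
  have "chi (- a) * cnj (chi (- b)) = chi (b - a)" for a b
  proof -
    have "chi (- a) * chi b = chi (b - a)"
      using chi unfolding additive_character_def by (metis uminus_add_conv_diff)
    then show ?thesis using additive_character_minus[OF chi, of b] by simp
  qed
  then have *: "f x * chi (dot_prod (- m) x) * (cnj (f y) * cnj (chi (dot_prod (- m) y))) =
      f x * cnj (f y) * chi (dot_prod m (y - x))" for x y
    by (metis (no_types, lifting) dot_prod_minus_left dot_prod_diff_right mult.assoc
        mult.left_commute)
  have "complex_of_real ((cmod (fourier chi f m))\<^sup>2) = (Q * cnj Q) *
      ((\<Sum>x\<in>UNIV. f x * chi (dot_prod (- m) x)) * cnj (\<Sum>x\<in>UNIV. f x * chi (dot_prod (- m) x)))"
    by (simp only: complex_norm_square fourier_def Q_def complex_cnj_mult mult_ac)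
  also have "\<dots> = (Q * cnj Q) *
      (\<Sum>x\<in>UNIV. \<Sum>y\<in>UNIV. f x * cnj (f y) * chi (dot_prod m (y - x)))"
    by (simp only: cnj_sum complex_cnj_mult sum_product *)
  finally show ?thesis by (simp only: Q)
qed

theorem theorem4p2:
  fixes chi :: "'q::{field,finite} \<Rightarrow> complex"
    and U :: "('q ^ 'n) set"
    and t :: "nat \<Rightarrow> 'q ^ 'n"
    and f :: "'q ^ 'n \<Rightarrow> complex"
    and k :: nat
  assumes "nontrivial_additive_character chi"
    and "k \<le> CARD('n)"
    and "vec.subspace U"
    and "vec.dim U = CARD('n) - k"
    and "bij_betw (\<lambda>j. translate U (t j)) {1..CARD('q) ^ k} (range (translate U))"
  shows "(\<Sum>m\<in>perp U. (cmod (fourier chi f m))\<^sup>2) =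
    real CARD('q) powi (- 2 * int CARD('n) + int k) *
      (\<Sum>j = 1..CARD('q) ^ k. (cmod (sum_over f (translate U (t j))))\<^sup>2)"
proof -
  note chi = assms(1) and U = assms(3)
  define Q :: complex where "Q = of_nat CARD('q) powi (- 2 * int CARD('n))"
  have add: "additive_character chi"
    using chi by (simp add: nontrivial_additive_character_def)
  \<comment> \<open>Both products equal q^n, so \<open>perp U\<close> has as many elements as there
    are cosets of \<open>U\<close>; the given enumeration says that this number is q^k.\<close>
  have "card U * card (range (translate U)) = card U * card (perp U)"
    using card_mult_card_perp[OF chi U] card_cosets_mult_card[OF U] by (simp add: mult.commute)
  moreover have "card U \<noteq> 0"
    using vec.subspace_0[OF U] by (auto simp: card_eq_0_iff)
  moreover have "card (range (translate U)) = CARD('q) ^ k"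
    using bij_betw_same_card[OF assms(5)] by simp
  ultimately have card_perp: "card (perp U) = CARD('q) ^ k"
    by simp
  \<comment> \<open>Orthogonality over \<open>perp U\<close> tests whether \<open>y - x\<close> lies
    in the double complement, which is \<open>U\<close>; that is, whether \<open>x\<close> and
    \<open>y\<close> share a coset.\<close>
  have sum_chi: "(\<Sum>m\<in>perp U. chi (dot_prod m (y - x))) =
      (if y \<in> translate U x then of_nat CARD('q) ^ k else 0)" for x y
    by (simp add: sum_character_subspace[OF chi subspace_perp] perp_perp[OF chi U] card_perp
        mem_translate_iff)
  have "complex_of_real (\<Sum>m\<in>perp U. (cmod (fourier chi f m))\<^sup>2) =
      Q * (\<Sum>m\<in>perp U. \<Sum>x\<in>UNIV. \<Sum>y\<in>UNIV. f x * cnj (f y) * chi (dot_prod m (y - x)))"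
    by (simp only: of_real_sum norm_fourier_square[OF add] Q_def sum_distrib_left)
  \<comment> \<open>Two interchanges move the sum over \<open>m\<close> innermost, where
    \<open>sum_chi\<close> evaluates it.\<close>
  also have "\<dots> = Q *
      (\<Sum>x\<in>UNIV. \<Sum>y\<in>UNIV. \<Sum>m\<in>perp U. f x * cnj (f y) * chi (dot_prod m (y - x)))"
    by (subst sum.swap, subst (2) sum.swap) (rule refl)
  also have "\<dots> = Q * (\<Sum>x\<in>UNIV. \<Sum>y\<in>UNIV.
      if y \<in> translate U x then f x * cnj (f y) * of_nat CARD('q) ^ k else 0)"
    by (simp add: sum_distrib_left[symmetric] sum_chi if_distrib[of "\<lambda>z. _ * z"] cong: if_cong)
  also have "\<dots> = Q * of_nat CARD('q) ^ k *
      (\<Sum>x\<in>UNIV. \<Sum>y\<in>translate U x. f x * cnj (f y))"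
    by (simp add: sum.If_cases sum_distrib_left mult_ac)
  also have "\<dots> = Q * of_nat CARD('q) ^ k *
      complex_of_real (\<Sum>C\<in>range (translate U). (cmod (sum_over f C))\<^sup>2)"
    by (simp only: sum_norm_sum_over_cosets[OF U])
  also have "(\<Sum>C\<in>range (translate U). (cmod (sum_over f C))\<^sup>2) =
      (\<Sum>j = 1..CARD('q) ^ k. (cmod (sum_over f (translate U (t j))))\<^sup>2)"
    by (rule sum.reindex_bij_betw[OF assms(5), symmetric])
  also have "Q * of_nat CARD('q) ^ k =
      complex_of_real (real CARD('q) powi (- 2 * int CARD('n) + int k))"
    using power_int_add[of "complex_of_nat CARD('q)" "- 2 * int CARD('n)" "int k"]
    by (simp add: Q_def)
  finally show ?thesis
    by (simp only: of_real_mult[symmetric] of_real_eq_iff)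
qed

end
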